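(* There exists a Parry numeration system $U$ such that the class of $U$-automatic sequences is not closed under periodic deletion; that is, there exist a Parry numeration system $U$, a $U$-automatic infinite word $\mathbf{x}=(x_n)_{n\ge0}$ over a finite alphabet and an integer $t\ge2$ such that the infinite word $\mathbf{y}=(x_{tn})_{n\ge0}$, obtained from $\mathbf{x}$ by keeping only the letters at positions $0,t,2t,3t,\ldots$, is not $U$-automatic.
   Context: Numeration systems. A (positional) numeration system is an increasing sequence $U=(U_n)_{n\ge 0}$ of integers with $U_0=1$ and $C_U:=\sup_{n\ge 0}\lceil U_{n+1}/U_n\rceil<+\infty$. Put $A_U=\{0,\ldots,C_U-1\}$. The greedy representation of a positive integer $n$ is the word $\mathrm{rep}_U(n)=w_{\ell-1}\cdots w_0$ over $A_U$ with $\sum_{i=0}^{\ell-1}w_iU_i=n$, $w_{\ell-1}\neq 0$ and $\sum_{i=0}^{j-1}w_iU_i<U_j$ for all $j\in\{1,\ldots,\ell\}$; $\mathrm{rep}_U(0)=\varepsilon$ is the empty word. Parry numeration systems. Let $\beta>1$ be real. The $\beta$-expansion of $x\in[0,1]$ is the lexicographically greatest sequence $d_\beta(x)=(x_i)_{i\ge1}$ of nonnegative integers with $x=\sum_{i\ge1}x_i\beta^{-i}$. If $d_\beta(1)=t_1\cdots t_m0^\omega$ with $t_m\neq0$, set $d_\beta^*(1)=(t_1\cdots t_{m-1}(t_m-1))^\omega$; otherwise set $d_\beta^*(1)=d_\beta(1)$. The number $\beta$ is a Parry number if $d^*_\beta(1)$ is ultimately periodic. Writing $d_\beta^*(1)=(t_i)_{i\ge1}$,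 the numeration system $U_\beta=(U_n)_{n\ge0}$ canonically associated with $\beta$ is given by $U_n=t_1U_{n-1}+\cdots+t_nU_0+1$ for all $n\ge0$. A Parry numeration system is a numeration system $U$ with $U=U_\beta$ for some Parry number $\beta$. Automatic sequences. An infinite word $\mathbf{x}=(x_n)_{n\ge0}$ over a finite alphabet $B$ is $U$-automatic if there is a complete deterministic finite automaton with output $(Q,q_0,A_U,\delta,\tau)$, with transition function $\delta\colon Q\times A_U\to Q$ (extended to words, read from left to right, most significant digit first) and output function $\tau\colon Q\to B$, such that $\delta(q_0,0)=q_0$ and $x_n=\tau(\delta(q_0,\mathrm{rep}_U(n)))$ for all $n\ge0$. *)

theory Defs
  imports Complex_Main
begin

section \<open>Numeration systems\<close>

text \<open>The terms are taken in \<^typ>\<open>nat\<close>: an increasing integer sequence starting at 1 is positive.\<close>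

definition numeration_system :: "(nat \<Rightarrow> nat) \<Rightarrow> bool" where
  "numeration_system U \<longleftrightarrow>
     strict_mono U \<and> U 0 = 1 \<and>
     bdd_above (range (\<lambda>n. \<lceil>real (U (Suc n)) / real (U n)\<rceil>))"

definition digit_bound :: "(nat \<Rightarrow> nat) \<Rightarrow> nat" where
  "digit_bound U = nat (SUP n. \<lceil>real (U (Suc n)) / real (U n)\<rceil>)"

definition digits :: "(nat \<Rightarrow> nat) \<Rightarrow> nat set" where
  "digits U = {..<digit_bound U}"

text \<open>Words are lists with the most significant digit first, so that the digit of weight
  \<open>U i\<close> in \<open>w\<close> is \<open>rev w ! i\<close>.\<close>

definition is_greedy_rep :: "(nat \<Rightarrow> nat) \<Rightarrow> nat \<Rightarrow> nat list \<Rightarrow> bool" where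
  "is_greedy_rep U n w \<longleftrightarrow>
     w \<noteq> [] \<and> set w \<subseteq> digits U \<and> hd w \<noteq> 0 \<and>
     (\<Sum>i<length w. rev w ! i * U i) = n \<and>
     (\<forall>j\<in>{1..length w}. (\<Sum>i<j. rev w ! i * U i) < U j)"

definition rep :: "(nat \<Rightarrow> nat) \<Rightarrow> nat \<Rightarrow> nat list" where
  "rep U n = (if n = 0 then [] else (THE w. is_greedy_rep U n w))"

section \<open>Parry numeration systems\<close>

text \<open>Digit sequences are indexed from 0: the entry \<open>a i\<close> is the digit of weight
  \<open>\<beta>\<close> to the power \<open>-(i + 1)\<close>.\<close>

definition is_beta_rep :: "real \<Rightarrow> real \<Rightarrow> (nat \<Rightarrow> nat) \<Rightarrow> bool" where
  "is_beta_rep \<beta> x a \<longleftrightarrow> (\<lambda>i. real (a i) / \<beta> ^ Suc i) sums x"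

definition seq_lex_less :: "(nat \<Rightarrow> nat) \<Rightarrow> (nat \<Rightarrow> nat) \<Rightarrow> bool" where
  "seq_lex_less a b \<longleftrightarrow> (\<exists>k. (\<forall>i<k. a i = b i) \<and> a k < b k)"

definition beta_expansion :: "real \<Rightarrow> real \<Rightarrow> nat \<Rightarrow> nat" where
  "beta_expansion \<beta> x =
     (THE a. is_beta_rep \<beta> x a \<and>
        (\<forall>b. is_beta_rep \<beta> x b \<longrightarrow> b = a \<or> seq_lex_less b a))"

text \<open>In the finite case below, the index \<open>m\<close> of the last nonzero digit corresponds to position
  \<open>m + 1\<close> of the usual indexing, hence the period \<open>Suc m\<close>.\<close>

definition is_last_nonzero :: "(nat \<Rightarrow> nat) \<Rightarrow> nat \<Rightarrow> bool" where
  "is_last_nonzero d m \<longleftrightarrow> d m \<noteq> 0 \<and> (\<forall>i>m. d i = 0)"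

definition quasi_greedy_expansion :: "real \<Rightarrow> nat \<Rightarrow> nat" where
  "quasi_greedy_expansion \<beta> =
     (let d = beta_expansion \<beta> 1 in
      if \<exists>m. is_last_nonzero d m
      then let m = (THE m. is_last_nonzero d m)
           in (\<lambda>i. if i mod Suc m = m then d m - 1 else d (i mod Suc m))
      else d)"

definition ultimately_periodic :: "(nat \<Rightarrow> 'a) \<Rightarrow> bool" where
  "ultimately_periodic a \<longleftrightarrow> (\<exists>p>0. \<exists>N. \<forall>i\<ge>N. a (i + p) = a i)"

definition Parry_number :: "real \<Rightarrow> bool" where
  "Parry_number \<beta> \<longleftrightarrow> \<beta> > 1 \<and> ultimately_periodic (quasi_greedy_expansion \<beta>)"

fun canonical_seq :: "(nat \<Rightarrow> nat) \<Rightarrow> nat \<Rightarrow> nat" where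
  "canonical_seq t n = (\<Sum>i<n. t i * canonical_seq t (n - 1 - i)) + 1"

declare canonical_seq.simps [simp del]

definition Parry_numeration_system :: "(nat \<Rightarrow> nat) \<Rightarrow> bool" where
  "Parry_numeration_system U \<longleftrightarrow>
     numeration_system U \<and>
     (\<exists>\<beta>. Parry_number \<beta> \<and> U = canonical_seq (quasi_greedy_expansion \<beta>))"

section \<open>Automatic sequences\<close>

definition complete_dfao ::
  "'q set \<Rightarrow> 'q \<Rightarrow> 'a set \<Rightarrow> ('q \<Rightarrow> 'a \<Rightarrow> 'q) \<Rightarrow> 'b set \<Rightarrow> ('q \<Rightarrow> 'b) \<Rightarrow> bool" where
  "complete_dfao Q q0 A \<delta> B \<tau> \<longleftrightarrow>
     finite Q \<and> q0 \<in> Q \<and> (\<forall>q\<in>Q. \<forall>a\<in>A. \<delta> q a \<in> Q) \<and> (\<forall>q\<in>Q. \<tau> q \<in> B)"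

text \<open>States are drawn from \<^typ>\<open>nat\<close>; since state sets are finite this is no restriction.\<close>

definition automatic :: "(nat \<Rightarrow> nat) \<Rightarrow> 'b set \<Rightarrow> (nat \<Rightarrow> 'b) \<Rightarrow> bool" where
  "automatic U B x \<longleftrightarrow>
     (\<exists>(Q :: nat set) q0 \<delta> \<tau>.
        complete_dfao Q q0 (digits U) \<delta> B \<tau> \<and> \<delta> q0 0 = q0 \<and>
        (\<forall>n. x n = \<tau> (foldl \<delta> q0 (rep U n))))"

end

theory Submission
  imports Defs
begin

text \<open>Let \<open>\<beta>\<close> be the Parry number with \<open>d\<^sub>\<beta>(1) = 30021\<close>. Its canonical system satisfies
  \<open>U\<^sub>n\<^sub>+\<^sub>5 = 3U\<^sub>n\<^sub>+\<^sub>4 + 2U\<^sub>n\<^sub>+\<^sub>1 + U\<^sub>n\<close>, and the characteristic polynomial is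
  \<open>(X\<^sup>3 - 2X\<^sup>2 - 3X - 1)(X\<^sup>2 - X + 1)\<close>. The expansion of \<open>1/5\<close> in base \<open>\<beta>\<close> is purely periodic
  with period \<open>v = 011210\<close>, but in the system \<open>U\<close> every block \<open>v\<close> leaves an error coming from
  the cofactor \<open>X\<^sup>2 - X + 1\<close>, whose roots are sixth roots of unity. Since 6 is the period length,
  these errors add up: \<open>U(m + 6i) = 5 val(v\<^sup>i0\<^sup>m) + U(m) + 2i\<close> if \<open>m mod 6 = 3\<close>. Hence the tail
  \<open>s\<close> in \<open>rep(U(m + 6i)/5) = v\<^sup>is\<close> determines \<open>i\<close>, and no finite automaton can check this. So the
  characteristic sequence of \<open>{U\<^sub>k | k \<ge> 0}\<close> is automatic, but keeping every fifth letter of it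
  destroys automaticity.\<close>

section \<open>Greedy representations\<close>

fun word_val :: "(nat \<Rightarrow> nat) \<Rightarrow> nat list \<Rightarrow> nat" where
  "word_val U [] = 0"
| "word_val U (a # w) = a * U (length w) + word_val U w"

text \<open>Leading zeros are allowed here, so that words can be padded to a prescribed length and
  glued together; the recursion on suffixes fits induction from the most significant digit.\<close>

fun greedy_word :: "(nat \<Rightarrow> nat) \<Rightarrow> nat list \<Rightarrow> bool" where
  "greedy_word U [] \<longleftrightarrow> True"
| "greedy_word U (a # w) \<longleftrightarrow> word_val U (a # w) < U (Suc (length w)) \<and> greedy_word U w"

lemma sum_rev_Cons:
  "j \<le> length w \<Longrightarrow> (\<Sum>i<j. rev (a # w) ! i * U i) = (\<Sum>i<j. rev w ! i * U i)"
  by (intro sum.cong) (auto simp: nth_append)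

lemma word_val_eq_sum: "word_val U w = (\<Sum>i<length w. rev w ! i * U i)"
proof (induction w)
  case (Cons a w)
  have "(\<Sum>i<length (a # w). rev (a # w) ! i * U i)
      = (\<Sum>i<length w. rev (a # w) ! i * U i) + rev (a # w) ! length w * U (length w)"
    by (simp only: length_Cons sum.lessThan_Suc)
  moreover have "rev (a # w) ! length w = a"
    by (simp add: nth_append)
  ultimately show ?case
    using Cons sum_rev_Cons[of "length w" w a U] by (simp only: word_val.simps)
qed simp

lemma greedy_word_iff:
  "greedy_word U w \<longleftrightarrow> (\<forall>j\<in>{1..length w}. (\<Sum>i<j. rev w ! i * U i) < U j)"
proof (induction w)
  case (Cons a w)
  have "{1..length (a # w)} = insert (Suc (length w)) {1..length w}"
    by auto
  moreover have "(\<Sum>i<Suc (length w). rev (a # w) ! i * U i) = word_val U (a # w)"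
    by (simp only: word_val_eq_sum length_Cons)
  moreover have "(\<forall>j\<in>{1..length w}. (\<Sum>i<j. rev (a # w) ! i * U i) < U j)
      \<longleftrightarrow> (\<forall>j\<in>{1..length w}. (\<Sum>i<j. rev w ! i * U i) < U j)"
    by (intro ball_cong refl) (metis atLeastAtMost_iff sum_rev_Cons)
  ultimately show ?case
    using Cons by (simp only: greedy_word.simps ball_simps)
qed simp

lemma word_val_replicate_0 [simp]: "word_val U (replicate k 0) = 0"
  by (induction k) auto

context
  fixes U :: "nat \<Rightarrow> nat"
  assumes U: "numeration_system U"
begin

lemma strict_mono_numeration: "strict_mono U"
  using U by (simp add: numeration_system_def)

lemma U_0: "U 0 = 1"
  using U by (simp add: numeration_system_def)

lemma U_pos: "U n > 0"
  using strict_mono_less_eq[OF strict_mono_numeration, of 0 n] U_0 by linarith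

lemma index_le_numeration: "n \<le> U n"
  using strict_mono_numeration by (rule strict_mono_imp_increasing)

text \<open>An integer strictly below a ratio of consecutive terms is strictly below its ceiling,
  hence below the supremum. So greediness alone keeps digits in the alphabet.\<close>

lemma digit_in_digits:
  assumes "a * U n < U (Suc n)"
  shows "a \<in> digits U"
proof -
  let ?r = "\<lambda>n. \<lceil>real (U (Suc n)) / real (U n)\<rceil>"
  have "real a * real (U n) < real (U (Suc n))"
    using assms by (metis of_nat_less_iff of_nat_mult)
  then have "real a < real (U (Suc n)) / real (U n)"
    using U_pos[of n] by (simp add: field_simps)
  then have "int a < ?r n"
    by linarith
  also have "?r n \<le> (SUP n. ?r n)"
    using U by (intro cSUP_upper) (auto simp: numeration_system_def)
  finally show ?thesis
    by (auto simp: digits_def digit_bound_def)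
qed

lemma greedy_word_less: "greedy_word U w \<Longrightarrow> word_val U w < U (length w)"
  using U_0 by (cases w) auto

lemma greedy_word_digits: "greedy_word U w \<Longrightarrow> set w \<subseteq> digits U"
proof (induction w)
  case (Cons a w)
  then have "a * U (length w) < U (Suc (length w))" by simp
  then show ?case
    using Cons digit_in_digits[of a "length w"] by simp
qed simp

lemma is_greedy_rep_iff:
  "is_greedy_rep U n w \<longleftrightarrow> w \<noteq> [] \<and> hd w \<noteq> 0 \<and> word_val U w = n \<and> greedy_word U w"
  using greedy_word_digits[of w] unfolding is_greedy_rep_def greedy_word_iff word_val_eq_sum by auto

text \<open>The tail has value below the weight of the leading digit, so that digit and the value of
  the tail are a quotient and a remainder.\<close>

lemma greedy_word_unique:
  assumes "greedy_word U w" "greedy_word U w'" "length w = length w'"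
    "word_val U w = word_val U w'"
  shows "w = w'"
  using assms
proof (induction w arbitrary: w')
  case (Cons a w)
  then obtain b u where w': "w' = b # u"
    by (cases w') auto
  have digit: "word_val U (c # z) div U (length z) = c"
      "word_val U (c # z) mod U (length z) = word_val U z"
    if "greedy_word U z" for c z
    using greedy_word_less[OF that] by auto
  have "a = b" "word_val U w = word_val U u"
    using digit[of w a] digit[of u b] Cons.prems w' by auto
  then show ?case
    using Cons.IH[of u] Cons.prems w' by simp
qed simp

lemma greedy_word_lower:
  "w \<noteq> [] \<Longrightarrow> hd w \<noteq> 0 \<Longrightarrow> U (length w - 1) \<le> word_val U w"
  by (cases w) (auto simp: trans_le_add1)

text \<open>The value fixes the length: a greedy word of length \<open>l > 0\<close> without leading
  zero has value at least \<open>U (l - 1)\<close> and less than \<open>U l\<close>.\<close>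

lemma is_greedy_rep_unique:
  assumes "is_greedy_rep U n w" "is_greedy_rep U n w'"
  shows "w = w'"
proof -
  have le: "length u \<le> length z" if "is_greedy_rep U n u" "is_greedy_rep U n z" for u z
  proof (rule ccontr)
    assume "\<not> length u \<le> length z"
    then have "U (length z) \<le> U (length u - 1)"
      using strict_mono_less_eq[OF strict_mono_numeration] by auto
    then show False
      using that greedy_word_lower[of u] greedy_word_less[of z] by (auto simp: is_greedy_rep_iff)
  qed
  then have "length w = length w'"
    using assms by (meson le_antisym)
  then show ?thesis
    using assms greedy_word_unique[of w w'] by (simp add: is_greedy_rep_iff)
qed

lemma rep_word_val:
  "greedy_word U w \<Longrightarrow> rep U (word_val U w) = dropWhile (\<lambda>a. a = 0) w"
proof (induction w)
  case (Cons a w)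
  show ?case
  proof (cases "a = 0")
    case False
    then have "is_greedy_rep U (word_val U (a # w)) (a # w)"
      using Cons.prems by (simp add: is_greedy_rep_iff)
    then have "(THE z. is_greedy_rep U (word_val U (a # w)) z) = a # w"
      using is_greedy_rep_unique by blast
    then show ?thesis
      using False U_pos[of "length w"] by (simp add: rep_def)
  qed (use Cons in simp)
qed (simp add: rep_def)

text \<open>Leading zeros do not move the automaton away from \<open>q\<close>, so any padded greedy
  word may replace the representation.\<close>

lemma foldl_rep_word_val:
  assumes "greedy_word U w" "\<delta> q 0 = q"
  shows "foldl \<delta> q (rep U (word_val U w)) = foldl \<delta> q w"
proof -
  have "foldl \<delta> q (dropWhile (\<lambda>a. a = 0) w) = foldl \<delta> q w"
    by (induction w) (auto simp: assms(2))
  then show ?thesis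
    using assms rep_word_val by simp
qed

text \<open>The greedy algorithm: divide by \<open>U m\<close> and recurse on the remainder, padding
  to length exactly \<open>m\<close>.\<close>

lemma greedy_word_exists:
  "n < U m \<Longrightarrow> \<exists>w. greedy_word U w \<and> length w = m \<and> word_val U w = n"
proof (induction m arbitrary: n)
  case (Suc m)
  from Suc.IH[of "n mod U m"] obtain w
    where w: "greedy_word U w" "length w = m" "word_val U w = n mod U m"
    using U_pos[of m] by auto
  then have "word_val U (n div U m # w) = n"
    by simp
  with w Suc.prems show ?case
    by (intro exI[of _ "n div U m # w"]) auto
qed (use U_0 in auto)

section \<open>The characteristic sequence of the basis\<close>

lemma automatic_range: "automatic U {0, 1 :: nat} (\<lambda>n. if n \<in> range U then 1 else 0)"
proof -
  \<comment> \<open>State 0 has seen only zeros, state 1 a word in \<open>0*10*\<close>, and state 2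
    is a sink.\<close>
  define \<delta> :: "nat \<Rightarrow> nat \<Rightarrow> nat" where
    "\<delta> q a = (if q = 0 \<and> a = 0 then 0
      else if q = 0 \<and> a = 1 \<or> q = 1 \<and> a = 0 then 1 else 2)" for q a
  define \<tau> :: "nat \<Rightarrow> nat" where "\<tau> q = (if q = 1 then 1 else 0)" for q
  have step [simp]: "\<delta> 0 0 = 0" "\<delta> 0 1 = 1" "a > 1 \<Longrightarrow> \<delta> 0 a = 2" "\<delta> 1 0 = 1"
      "a \<noteq> 0 \<Longrightarrow> \<delta> 1 a = 2" "\<delta> 2 a = 2" for a
    by (simp_all add: \<delta>_def)
  have sink: "foldl \<delta> 2 w = 2" for w
    by (induction w) simp_all
  have zeros: "foldl \<delta> 1 w = 1 \<longleftrightarrow> set w \<subseteq> {0}" for w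
  proof (induction w)
    case (Cons a w)
    then show ?case
      using sink[of w] by (cases "a = 0") (simp_all del: One_nat_def)
  qed simp
  have zero_val: "set w \<subseteq> {0} \<Longrightarrow> word_val U w = 0" for w
    by (induction w) auto
  \<comment> \<open>This direction needs no greediness: every word in \<open>0*10*\<close> has some
    \<open>U k\<close> as its value.\<close>
  have acc: "foldl \<delta> 0 w = 1 \<Longrightarrow> word_val U w \<in> range U" for w
  proof (induction w)
    case (Cons a w)
    consider "a = 0" | "a = 1" | "a > 1" by linarith
    then show ?case
    proof cases
      case 2
      then have "set w \<subseteq> {0}"
        using Cons.prems zeros[of w] by (simp del: One_nat_def)
      then show ?thesis
        using 2 zero_val by simp
    next
      case 3
      then show ?thesis
        using Cons.prems sink[of w] by simp
    qed (use Cons in simp)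
  qed simp
  have "foldl \<delta> 0 (rep U n) = 1 \<longleftrightarrow> n \<in> range U" for n
  proof
    assume *: "foldl \<delta> 0 (rep U n) = 1"
    have "n < U (Suc n)"
      using index_le_numeration[of "Suc n"] by linarith
    then obtain w where "greedy_word U w" "word_val U w = n"
      using greedy_word_exists by blast
    then show "n \<in> range U"
      using * acc[of w] foldl_rep_word_val[of w \<delta> 0] by simp
  next
    assume "n \<in> range U"
    then obtain k where k: "n = U k" by auto
    have "greedy_word U (replicate k 0)"
      by (induction k) (auto simp: U_pos)
    then have "greedy_word U (1 # replicate k 0)"
      using strict_mono_less[OF strict_mono_numeration, of k "Suc k"] by simp
    moreover have "foldl \<delta> 0 (1 # replicate k 0) = 1"
      using zeros[of "replicate k 0"] by (auto simp del: One_nat_def)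
    ultimately show "foldl \<delta> 0 (rep U n) = 1"
      using foldl_rep_word_val[of "1 # replicate k 0" \<delta> 0] k by simp
  qed
  then have "\<forall>n. (if n \<in> range U then 1 else 0) = \<tau> (foldl \<delta> 0 (rep U n))"
    by (simp add: \<tau>_def)
  moreover have "complete_dfao {0, 1, 2} 0 (digits U) \<delta> {0, 1} \<tau>" "\<delta> 0 0 = 0"
    by (simp_all add: complete_dfao_def \<delta>_def \<tau>_def)
  ultimately show ?thesis
    unfolding automatic_def by blast
qed

end

section \<open>Expansions of 1\<close>

text \<open>A sequence that first differs from \<open>d\<close> by a larger digit at
  \<open>k\<close> already has a partial sum exceeding 1, by \<open>tail\<close>; so
  \<open>d\<close> is lexicographically greatest.\<close>

lemma beta_expansion_eqI:
  assumes "\<beta> > 0" and rep: "is_beta_rep \<beta> 1 d"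
    and tail: "\<And>k. (\<Sum>i<k. real (d i) / \<beta> ^ Suc i) + (real (d k) + 1) / \<beta> ^ Suc k > 1"
  shows "beta_expansion \<beta> 1 = d"
proof -
  have less: "seq_lex_less b d" if b: "is_beta_rep \<beta> 1 b" "b \<noteq> d" for b
  proof -
    have "\<exists>k. b k \<noteq> d k"
      using b(2) by blast
    then obtain k where neq: "b k \<noteq> d k" and eq: "\<And>i. i < k \<Longrightarrow> b i = d i"
      using exists_least_iff[of "\<lambda>k. b k \<noteq> d k"] by blast
    have "\<not> d k < b k"
    proof
      assume "d k < b k"
      then have "real (d k) + 1 \<le> real (b k)" by linarith
      then have "(real (d k) + 1) / \<beta> ^ Suc k \<le> real (b k) / \<beta> ^ Suc k"
        using \<open>\<beta> > 0\<close> by (intro divide_right_mono) auto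
      then have "1 < (\<Sum>i<Suc k. real (b i) / \<beta> ^ Suc i)"
        using tail[of k] eq by simp
      also have "\<dots> \<le> 1"
        using b(1) \<open>\<beta> > 0\<close> sum_le_suminf[of "\<lambda>i. real (b i) / \<beta> ^ Suc i" "{..<Suc k}"]
        by (simp add: is_beta_rep_def sums_iff)
      finally show False by simp
    qed
    then show ?thesis
      unfolding seq_lex_less_def using neq eq by (intro exI[of _ k]) auto
  qed
  have irrefl: "\<not> (seq_lex_less a d \<and> seq_lex_less d a)" for a
  proof
    assume "seq_lex_less a d \<and> seq_lex_less d a"
    then obtain k l where "\<forall>i<k. a i = d i" "a k < d k" "\<forall>i<l. d i = a i" "d l < a l"
      by (auto simp: seq_lex_less_def)
    then show False
      by (metis linorder_neqE_nat order_less_asym less_irrefl)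
  qed
  show ?thesis
    unfolding beta_expansion_def
  proof (rule the_equality)
    fix a assume "is_beta_rep \<beta> 1 a \<and> (\<forall>b. is_beta_rep \<beta> 1 b \<longrightarrow> b = a \<or> seq_lex_less b a)"
    then show "a = d"
      using rep less irrefl by metis
  qed (use rep less in blast)
qed

lemma quasi_greedy_expansion_finite:
  assumes "beta_expansion \<beta> 1 = d" "is_last_nonzero d m"
  shows "quasi_greedy_expansion \<beta> i =
    (if i mod Suc m = m then d m - 1 else d (i mod Suc m))"
proof -
  have "n = m" if "is_last_nonzero d n" for n
    using that assms(2) unfolding is_last_nonzero_def by (metis linorder_neqE_nat)
  with assms(2) have last: "(THE m. is_last_nonzero d m) = m"
    by (rule the_equality)
  have ex: "\<exists>m. is_last_nonzero d m"
    using assms(2) by blast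
  show ?thesis
    unfolding quasi_greedy_expansion_def assms(1) Let_def if_P[OF ex] last ..
qed

text \<open>Split the defining sum after one period of \<open>t\<close>. By periodicity the
  remaining terms and the final 1 add up to \<open>U n\<close>, which restores the 1 subtracted from
  the last digit.\<close>

lemma canonical_seq_quasi_greedy_recurrence:
  assumes "\<And>i. t i = (if i mod Suc m = m then d m - 1 else d (i mod Suc m))" "d m > 0"
  shows "canonical_seq t (n + Suc m) =
    (\<Sum>i\<le>m. d i * canonical_seq t (n + m - i))"
proof -
  let ?U = "canonical_seq t"
  have d: "t i = d i" if "i < m" for i
    using assms(1) that by simp
  have dm: "t m = d m - 1"
    using assms(1) by simp
  have per: "t (i + Suc m) = t i" for i
    by (simp only: assms(1) mod_add_self2)
  have split: "(\<Sum>i<a + b. f i) = (\<Sum>i<a. f i) + (\<Sum>i<b. f (i + a))" for a b and f :: "nat \<Rightarrow> nat"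
    by (induction b) (auto simp: add.commute)
  have "?U (n + Suc m) = (\<Sum>i<n + Suc m. t i * ?U (n + m - i)) + 1"
    by (subst canonical_seq.simps) simp
  also have "(\<Sum>i<n + Suc m. t i * ?U (n + m - i))
      = (\<Sum>i<Suc m. t i * ?U (n + m - i))
        + (\<Sum>i<n. t (i + Suc m) * ?U (n + m - (i + Suc m)))"
    using split[where a = "Suc m" and b = n and f = "\<lambda>i. t i * ?U (n + m - i)"] by (simp only: add.commute)
  also have "(\<Sum>i<n. t (i + Suc m) * ?U (n + m - (i + Suc m))) = (\<Sum>i<n. t i * ?U (n - 1 - i))"
    by (intro sum.cong refl) (simp only: per, simp)
  also have "(\<Sum>i<Suc m. t i * ?U (n + m - i)) + (\<Sum>i<n. t i * ?U (n - 1 - i)) + 1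
      = (\<Sum>i<Suc m. t i * ?U (n + m - i)) + ?U n"
    by (subst (4) canonical_seq.simps) simp
  also have "\<dots> = (\<Sum>i<m. d i * ?U (n + m - i)) + (d m - 1) * ?U n + ?U n"
    using d dm by simp
  also have "\<dots> = (\<Sum>i\<le>m. d i * ?U (n + m - i))"
    using assms(2) by (cases "d m") (auto simp: lessThan_Suc_atMost[symmetric])
  finally show ?thesis .
qed

section \<open>The base with expansion 30021\<close>

definition digits_30021 :: "nat \<Rightarrow> nat" where
  "digits_30021 i = (if i = 0 then 3 else if i = 3 then 2 else if i = 4 then 1 else 0)"

lemma base_30021_exists: "\<exists>\<beta>::real. \<beta> > 3 \<and> \<beta> ^ 5 = 3 * \<beta> ^ 4 + 2 * \<beta> + 1"
proof -
  define f where "f x = x ^ 5 - 3 * x ^ 4 - 2 * x - 1" for x :: real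
  \<comment> \<open>The values at 3 and 4 are -7 and 247.\<close>
  have "\<exists>x\<ge>3. x \<le> 4 \<and> f x = 0"
    by (rule IVT') (auto simp: f_def intro!: continuous_intros)
  then obtain x where "x \<ge> 3" "f x = 0" by blast
  moreover have "x \<noteq> 3"
    using \<open>f x = 0\<close> by (auto simp: f_def)
  ultimately show ?thesis
    by (intro exI[of _ x]) (simp add: f_def)
qed

lemma beta_expansion_30021:
  fixes \<beta> :: real
  assumes "\<beta> > 3" and root: "\<beta> ^ 5 = 3 * \<beta> ^ 4 + 2 * \<beta> + 1"
  shows "beta_expansion \<beta> 1 = digits_30021"
proof (rule beta_expansion_eqI)
  let ?f = "\<lambda>i. real (digits_30021 i) / \<beta> ^ Suc i"
  have "(\<Sum>i<5. ?f i) = 3 / \<beta> + 2 / \<beta> ^ 4 + 1 / \<beta> ^ 5"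
    by (simp add: eval_nat_numeral digits_30021_def)
  also have "\<dots> = (3 * \<beta> ^ 4 + 2 * \<beta> + 1) / \<beta> ^ 5"
    using \<open>\<beta> > 3\<close> by (simp add: field_simps eval_nat_numeral)
  also have "\<dots> = 1"
    using \<open>\<beta> > 3\<close> by (simp flip: root)
  finally have sum: "(\<Sum>i<5. ?f i) = 1" .
  show "is_beta_rep \<beta> 1 digits_30021"
    unfolding is_beta_rep_def sum[symmetric]
    by (rule sums_finite) (auto simp: digits_30021_def)
  \<comment> \<open>Writing everything in powers of the inverse base makes the inequalities below
    linear.\<close>
  define c where "c k = 1 / \<beta> ^ k" for k
  have inv: "1 = 3 * c 1 + 2 * c 4 + c 5"
    using sum by (simp add: eval_nat_numeral digits_30021_def c_def)
  have step: "c k > 3 * c (Suc k)" for k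
    using \<open>\<beta> > 3\<close> by (simp add: field_simps c_def)
  have pos: "c k > 0" for k
    using \<open>\<beta> > 3\<close> by (simp add: c_def)
  have c: "x / \<beta> ^ k = x * c k" for x k
    by (simp add: c_def)
  show "(\<Sum>i<k. ?f i) + (real (digits_30021 k) + 1) / \<beta> ^ Suc k > 1" for k
  proof -
    \<comment> \<open>After cancelling with \<open>inv\<close>, the claim for \<open>k < 3\<close>
      is \<open>c (k + 1) > 2 * c 4 + c 5\<close>, for 3 it is \<open>c 4 > c 5\<close>, and for 4
      it is \<open>c 5 > 0\<close>. From 5 on the partial sum is already 1.\<close>
    consider "k = 0" | "k = 1" | "k = 2" | "k = 3" | "k = 4" | "k \<ge> 5" by linarith
    then show ?thesis
    proof cases
      case 6
      then have "(\<Sum>i<k. ?f i) = (\<Sum>i<5. ?f i)"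
        by (intro sum.mono_neutral_right) (auto simp: digits_30021_def)
      then show ?thesis
        using sum \<open>\<beta> > 3\<close> 6 by (simp add: digits_30021_def)
    qed (use inv step[of 1] step[of 2] step[of 3] step[of 4] pos[of 4] pos[of 5] in
        \<open>simp_all only: c, simp_all add: eval_nat_numeral digits_30021_def algebra_simps\<close>)
  qed
qed (use assms in simp)

lemma last_nonzero_30021: "is_last_nonzero digits_30021 4"
  by (simp add: is_last_nonzero_def digits_30021_def)

section \<open>The numeration system\<close>

context
  fixes U :: "nat \<Rightarrow> nat"
  assumes init: "U 0 = 1" "U 1 = 4" "U 2 = 13" "U 3 = 40" "U 4 = 123"
    and rec: "\<And>n. U (n + 5) = 3 * U (n + 4) + 2 * U (n + 1) + U n"
begin

section \<open>Growth of the basis\<close>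

lemma triple_le: "3 * U n \<le> U (Suc n)"
proof (cases "n < 4")
  case True
  then consider "n = 0" | "n = 1" | "n = 2" | "n = 3" by linarith
  then show ?thesis
    using init by cases (simp_all add: eval_nat_numeral)
next
  case False
  then show ?thesis
    using rec[of "n - 4"] by simp
qed

lemma le_quadruple: "U (Suc n) \<le> 4 * U n"
proof (cases "n < 4")
  case True
  then consider "n = 0" | "n = 1" | "n = 2" | "n = 3" by linarith
  then show ?thesis
    using init by cases (simp_all add: eval_nat_numeral)
next
  case False
  then obtain k where n: "n = k + 4"
    by (metis add.commute le_Suc_ex not_less)
  show ?thesis
    using rec[of k] triple_le[of k] triple_le[of "k + 1"] triple_le[of "k + 2"] triple_le[of "k + 3"]
    by (simp add: n eval_nat_numeral)
qed

lemma numeration_system_30021: "numeration_system U"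
  unfolding numeration_system_def
proof (intro conjI)
  have pos: "U n > 0" for n
  proof (induction n)
    case (Suc n)
    then show ?case using triple_le[of n] by linarith
  qed (simp add: init)
  have "U n < U (Suc n)" for n
    using triple_le[of n] pos[of n] by linarith
  then show "strict_mono U"
    by (simp add: strict_mono_Suc_iff)
  show "bdd_above (range (\<lambda>n. \<lceil>real (U (Suc n)) / real (U n)\<rceil>))"
  proof (rule bdd_aboveI2)
    fix n
    have "real (U (Suc n)) \<le> 4 * real (U n)"
      using le_quadruple[of n] by linarith
    then show "\<lceil>real (U (Suc n)) / real (U n)\<rceil> \<le> 4"
      using pos[of n] by (simp add: ceiling_le_iff divide_le_eq)
  qed
qed (simp add: init)

text \<open>Digits at most 2 can be prefixed freely: a greedy tail of length \<open>l\<close> has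
  value below \<open>U l\<close>, and \<open>3 * U l\<close> is at most
  \<open>U (l + 1)\<close>.\<close>

lemma greedy_word_append_le_2:
  "set w \<subseteq> {..2} \<Longrightarrow> greedy_word U s \<Longrightarrow> greedy_word U (w @ s)"
proof (induction w)
  case (Cons a w)
  then have "greedy_word U (w @ s)" by simp
  moreover have "a * U (length (w @ s)) \<le> 2 * U (length (w @ s))"
    using Cons.prems by simp
  moreover have "word_val U (w @ s) < U (length (w @ s))"
    using greedy_word_less[OF numeration_system_30021] calculation(1) .
  ultimately show ?case
    unfolding append_Cons greedy_word.simps word_val.simps
    using triple_le[of "length (w @ s)"] by linarith
qed simp

text \<open>The polynomial \<open>X^6 - 5(X^4 + 2X^3 + 2X^2 + X) - 1\<close> is divisible by
  \<open>X^3 - 2X^2 - 3X - 1\<close>. Applied to \<open>U\<close>, it leaves a sequence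
  \<open>E\<close> governed by the cofactor \<open>X^2 - X + 1\<close> alone, hence of period
  6.\<close>

lemma block_drift:
  "U (6 * r + 9) = 5 * (U (6 * r + 7) + 2 * U (6 * r + 6) + 2 * U (6 * r + 5) + U (6 * r + 4))
    + U (6 * r + 3) + 2"
proof -
  define E where "E m = int (U (m + 6)) - 5 * (int (U (m + 4)) + 2 * int (U (m + 3))
    + 2 * int (U (m + 2)) + int (U (m + 1))) - int (U m)" for m
  have E_rec: "E (m + 2) = E (m + 1) - E m" for m
  proof -
    have shift: "int (U (m + a)) = 3 * int (U (m + b)) + 2 * int (U (m + c)) + int (U (m + d))"
      if "a = d + 5" "b = d + 4" "c = d + 1" for a b c d
      using rec[of "m + d"] that by (simp add: add.assoc)
    have r: "int (U (m + 5)) = 3 * int (U (m + 4)) + 2 * int (U (m + 1)) + int (U m)"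
      "int (U (m + 6)) = 3 * int (U (m + 5)) + 2 * int (U (m + 2)) + int (U (m + 1))"
      "int (U (m + 7)) = 3 * int (U (m + 6)) + 2 * int (U (m + 3)) + int (U (m + 2))"
      "int (U (m + 8)) = 3 * int (U (m + 7)) + 2 * int (U (m + 4)) + int (U (m + 3))"
      by (use rec[of m] in simp) (rule shift; simp)+
    have shifts: "m + 2 + 6 = m + 8" "m + 2 + 4 = m + 6" "m + 2 + 3 = m + 5" "m + 2 + 2 = m + 4"
      "m + 2 + 1 = m + 3" "m + 1 + 6 = m + 7" "m + 1 + 4 = m + 5" "m + 1 + 3 = m + 4"
      "m + 1 + 2 = m + 3" "m + 1 + 1 = m + 2"
      by simp_all
    show ?thesis
      unfolding E_def shifts r by (simp only: ring_distribs)
  qed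
  have E_6: "E (m + 6) = E m" for m
  proof -
    have "E (m + 2) = E (m + 1) - E m" "E (m + 3) = E (m + 2) - E (m + 1)"
      "E (m + 4) = E (m + 3) - E (m + 2)" "E (m + 5) = E (m + 4) - E (m + 3)"
      "E (m + 6) = E (m + 5) - E (m + 4)"
      using E_rec[of m] E_rec[of "m + 1"] E_rec[of "m + 2"] E_rec[of "m + 3"] E_rec[of "m + 4"]
      by (simp_all only: add.assoc numeral_plus_numeral one_plus_numeral numeral_plus_one
          add_num_simps one_add_one)
    then show ?thesis by linarith
  qed
  \<comment> \<open>One value fixes \<open>E\<close> on the whole residue class of 3 modulo 6:
    \<open>34002 - 5 * 6792 - 40 = 2\<close>.\<close>
  have "U 5 = 378" "U 6 = 1164" "U 7 = 3585" "U 8 = 11041" "U 9 = 34002"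
    using init rec[of 0] rec[of 1] rec[of 2] rec[of 3] rec[of 4]
    by (simp_all flip: numeral_2_eq_2)
  then have E_3: "E 3 = 2"
    using init by (simp add: E_def)
  have "E (6 * r + 3) = 2"
  proof (induction r)
    case (Suc r)
    have "6 * Suc r + 3 = 6 * r + 3 + 6" by simp
    then show ?case
      using E_6[of "6 * r + 3"] Suc by (simp only:)
  qed (use E_3 in simp)
  moreover have shifts: "6 * r + 3 + 6 = 6 * r + 9" "6 * r + 3 + 4 = 6 * r + 7"
    "6 * r + 3 + 3 = 6 * r + 6" "6 * r + 3 + 2 = 6 * r + 5" "6 * r + 3 + 1 = 6 * r + 4"
    by simp_all
  ultimately have "int (U (6 * r + 9)) = int (5 * (U (6 * r + 7) + 2 * U (6 * r + 6)
      + 2 * U (6 * r + 5) + U (6 * r + 4)) + U (6 * r + 3) + 2)"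
    unfolding E_def shifts by simp
  then show ?thesis
    by (simp only: of_nat_eq_iff)
qed

text \<open>Modulo 5, \<open>U (6 * k + 3)\<close> grows by 2 with each \<open>k\<close>, starting
  from \<open>U 3 = 40\<close>; five steps bring it back to 0.\<close>

lemma five_dvd: "5 dvd U (30 * r + 3)"
proof -
  have "\<exists>c. U (6 * k + 3) = 5 * c + 2 * k" for k
  proof (induction k)
    case 0
    show ?case using init by (intro exI[of _ 8]) simp
  next
    case (Suc k)
    then obtain c where "U (6 * k + 3) = 5 * c + 2 * k" by blast
    then have "U (6 * k + 9) = 5 * (U (6 * k + 7) + 2 * U (6 * k + 6) + 2 * U (6 * k + 5)
        + U (6 * k + 4) + c) + 2 * Suc k"
      using block_drift[of k] by simp
    moreover have "6 * Suc k + 3 = 6 * k + 9" by simp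
    ultimately show ?case by metis
  qed
  from this[of "5 * r"] show ?thesis by auto
qed

text \<open>The block \<open>012210\<close> is the period of the expansion of 1/5, since the base
  satisfies \<open>X^6 - 1 = 5(X^4 + 2X^3 + 2X^2 + X)\<close>.\<close>

definition block_power :: "nat \<Rightarrow> nat list" where
  "block_power i = concat (replicate i [0, 1, 2, 2, 1, 0])"

lemma set_block_power: "set (block_power i) \<subseteq> {..2}"
  by (auto simp: block_power_def)

lemma length_block_power: "length (block_power i) = 6 * i"
  by (induction i) (simp_all add: block_power_def)

text \<open>Telescoping \<open>block_drift\<close>: each block prefixed to \<open>s\<close> occupies
  positions starting at a number congruent to 3 modulo 6 and contributes the same error 2, so the
  errors add up to \<open>2 * i\<close>.\<close>

lemma word_val_block_power:
  assumes "length s = 6 * r + 3"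
  shows "5 * word_val U (block_power i @ s) + U (6 * r + 3) + 2 * i
    = U (6 * (r + i) + 3) + 5 * word_val U s"
proof (induction i)
  case (Suc i)
  have "block_power (Suc i) @ s = [0, 1, 2, 2, 1, 0] @ (block_power i @ s)"
    by (simp add: block_power_def)
  moreover have "length (block_power i @ s) = 6 * (r + i) + 3"
    using assms by (simp add: length_block_power)
  ultimately have "word_val U (block_power (Suc i) @ s) = U (6 * (r + i) + 7)
      + 2 * U (6 * (r + i) + 6) + 2 * U (6 * (r + i) + 5) + U (6 * (r + i) + 4)
      + word_val U (block_power i @ s)"
    by (simp add: add.assoc eval_nat_numeral)
  moreover have "6 * (r + Suc i) + 3 = 6 * (r + i) + 9"
    by simp
  ultimately show ?case
    using Suc block_drift[of "r + i"] by (simp only: distrib_left mult_Suc_right)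
qed (simp add: block_power_def)

lemma not_automatic_30021:
  "\<not> automatic U B (\<lambda>n. if 5 * n \<in> range U then 1 else (0 :: nat))"
proof
  note numeration = numeration_system_30021
  assume "automatic U B (\<lambda>n. if 5 * n \<in> range U then 1 else (0 :: nat))"
  then obtain Q :: "nat set" and q0 \<delta> \<tau> where
    dfao: "complete_dfao Q q0 (digits U) \<delta> B \<tau>" and "\<delta> q0 0 = q0"
    and out: "\<And>n. (if 5 * n \<in> range U then 1 else 0) = \<tau> (foldl \<delta> q0 (rep U n))"
    unfolding automatic_def by blast
  \<comment> \<open>Blocks are taken five at a time so that the drift \<open>10 * i\<close> is
    divisible by 5 and a change of \<open>2 * i\<close> in the value of the tail can compensate
    it.\<close>
  define f where "f i = foldl \<delta> q0 (block_power (5 * i))" for i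
  have "foldl \<delta> q w \<in> Q" if "set w \<subseteq> digits U" "q \<in> Q" for q w
    using that dfao by (induction w arbitrary: q) (auto simp: complete_dfao_def)
  moreover have "set (block_power i) \<subseteq> digits U" for i
    using greedy_word_append_le_2[OF set_block_power, of "[]" i]
      greedy_word_digits[OF numeration] by simp
  ultimately have "range f \<subseteq> Q"
    using dfao by (auto simp: f_def complete_dfao_def)
  then have "finite (range f)"
    using dfao finite_subset by (auto simp: complete_dfao_def)
  then have "\<not> inj f"
    using finite_imageD infinite_UNIV_nat by blast
  then obtain i j where "i < j" and state: "f i = f j"
    unfolding inj_def by (metis linorder_neqE_nat)
  \<comment> \<open>This length makes \<open>U m\<close> divisible by 5 and leaves room for the
    correction \<open>2 * i\<close>.\<close>
  define m where "m = 30 * j + 3"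
  have m: "m = 6 * (5 * j) + 3"
    by (simp add: m_def)
  have U_m: "5 * (U m div 5) = U m" "m \<le> U m"
    using five_dvd[of j] index_le_numeration[OF numeration, of m] by (auto simp: m_def)
  then have "U m div 5 + 2 * i < U m"
    using \<open>i < j\<close> m_def by linarith
  then obtain s where s: "greedy_word U s" "length s = m" "word_val U s = U m div 5 + 2 * i"
    using greedy_word_exists[OF numeration] by blast
  \<comment> \<open>The correction in \<open>s\<close> cancels the drift exactly for
    \<open>k = i\<close>; for \<open>k = j\<close> the value misses a term of \<open>U\<close> by
    \<open>10 * (j - i)\<close>.\<close>
  have drift: "5 * word_val U (block_power (5 * k) @ s) + 10 * k
      = U (6 * (5 * j + 5 * k) + 3) + 10 * i" for k
    using word_val_block_power[of s "5 * j" "5 * k"] s U_m m by simp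
  have "(if 5 * word_val U (block_power (5 * k) @ s) \<in> range U then 1 else 0)
      = \<tau> (foldl \<delta> (f k) s)" for k
    using out foldl_rep_word_val[OF numeration greedy_word_append_le_2[OF set_block_power s(1)],
        of \<delta> q0 "5 * k"] \<open>\<delta> q0 0 = q0\<close>
    by (simp add: f_def)
  then have "5 * word_val U (block_power (5 * i) @ s) \<in> range U
      \<longleftrightarrow> 5 * word_val U (block_power (5 * j) @ s) \<in> range U"
    using state by (metis zero_neq_one)
  moreover have "5 * word_val U (block_power (5 * i) @ s) \<in> range U"
    using drift[of i] by simp
  ultimately obtain k where k: "5 * word_val U (block_power (5 * j) @ s) = U k"
    by auto
  \<comment> \<open>The value for \<open>k = j\<close> lies just below \<open>U (M + 1)\<close>. The
    gap between \<open>U M\<close> and \<open>U (M + 1)\<close> is at least \<open>2 * U M\<close>,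
    which exceeds \<open>10 * j\<close>, so no term of \<open>U\<close> fits.\<close>
  define M where "M = 60 * j + 2"
  have U_k: "U k + 10 * j = U (Suc M) + 10 * i"
  proof -
    have "6 * (5 * j + 5 * j) + 3 = Suc M"
      by (simp add: M_def)
    then show ?thesis
      using drift[of j] k by (simp only:)
  qed
  then have "U k < U (Suc M)"
    using \<open>i < j\<close> by linarith
  then have "U k \<le> U M"
    using strict_mono_less[OF strict_mono_numeration[OF numeration]]
      strict_mono_less_eq[OF strict_mono_numeration[OF numeration]] by simp
  moreover have "M \<le> U M"
    by (rule index_le_numeration[OF numeration])
  ultimately show False
    using U_k triple_le[of M] by (simp add: M_def)
qed

end

theorem theorem4p5:
  "\<exists>U. Parry_numeration_system U \<and>
     (\<exists>(B :: nat set) (x :: nat \<Rightarrow> nat) (t :: nat).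
        finite B \<and> range x \<subseteq> B \<and> t \<ge> 2 \<and>
        automatic U B x \<and> \<not> automatic U B (\<lambda>n. x (t * n)))"
proof -
  obtain \<beta> :: real where \<beta>: "\<beta> > 3" "\<beta> ^ 5 = 3 * \<beta> ^ 4 + 2 * \<beta> + 1"
    using base_30021_exists by blast
  define t where "t = quasi_greedy_expansion \<beta>"
  define U where "U = canonical_seq t"
  have t: "t i = (if i mod Suc 4 = 4 then digits_30021 4 - 1 else digits_30021 (i mod Suc 4))" for i
    unfolding t_def
    by (rule quasi_greedy_expansion_finite[OF beta_expansion_30021[OF \<beta>] last_nonzero_30021])
  have rec: "U (n + 5) = 3 * U (n + 4) + 2 * U (n + 1) + U n" for n
    using canonical_seq_quasi_greedy_recurrence[OF t, of n]
    by (simp add: U_def digits_30021_def eval_nat_numeral)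
  \<comment> \<open>The quasi-greedy expansion repeats \<open>30020\<close>. The recurrence starts
    only at \<open>U 5\<close>, so the first five terms come from the definition.\<close>
  have "t 0 = 3" "t (Suc 0) = 0" "t (Suc (Suc 0)) = 0" "t (Suc (Suc (Suc 0))) = 2"
    by (simp_all add: t digits_30021_def)
  note t_vals = this
  have U_eq: "U n = (\<Sum>i<n. t i * U (n - 1 - i)) + 1" for n
    unfolding U_def by (rule canonical_seq.simps)
  have "U 0 = 1"
    by (subst U_eq) simp
  moreover from this have "U 1 = 4"
    by (subst U_eq) (simp add: t_vals)
  moreover from calculation have "U 2 = 13"
    by (subst U_eq) (simp add: t_vals eval_nat_numeral)
  moreover from calculation have "U 3 = 40"
    by (subst U_eq) (simp add: t_vals eval_nat_numeral)
  moreover from calculation have "U 4 = 123"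
    by (subst U_eq) (simp add: t_vals eval_nat_numeral)
  ultimately have init: "U 0 = 1" "U 1 = 4" "U 2 = 13" "U 3 = 40" "U 4 = 123" .
  have "ultimately_periodic t"
    unfolding ultimately_periodic_def
    by (intro exI[of _ 5] conjI exI[of _ 0] allI impI) (simp_all add: t)
  then have "Parry_number \<beta>"
    using \<beta> by (simp add: Parry_number_def t_def)
  moreover have numeration: "numeration_system U"
    using numeration_system_30021[OF init rec] .
  ultimately have "Parry_numeration_system U"
    unfolding Parry_numeration_system_def U_def t_def by blast
  moreover have "\<not> automatic U {0, 1} (\<lambda>n. if 5 * n \<in> range U then 1 else (0 :: nat))"
    using not_automatic_30021[OF init rec] .
  ultimately show ?thesis
    using automatic_range[OF numeration]
    by (intro exI[of _ U] exI[of _ "{0, 1}"] conjI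
        exI[of _ "\<lambda>n. if n \<in> range U then 1 else 0"] exI[of _ 5]) auto
qed

end
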